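(* Let $A$ be an alphabet. For every submonoid $M \subseteq A^*$ there exists a submonoid $N \subseteq A^*$ such that $M \subseteq N$, $M \preceq N$, and $N$ is maximal with respect to the partial order $\preceq$ on the set of submonoids of $A^*$.
   Context: $A^*$ is the monoid of finite words over $A$ under concatenation, with the empty word $1$ as neutral element. Free product: let $N$ be a monoid generated by submonoids $M$ and $L$. An expression $m_1 m_2\cdots m_r$ ($r\ge 0$) of an element of $N$ is in reduced form with respect to $M, L$ if each $m_i \neq 1$, each $m_i$ belongs to $M$ or $L$, and consecutive factors $m_i, m_{i+1}$ are taken from different ones of the two submonoids. One writes $N = M * L$ (the free product of its submonoids $M$ and $L$) if $N$ is generated by $M\cup L$ and every element of $N$ has a unique expression in reduced form with respect to $M, L$. ($L$ may be the trivial monoid $\{1\}$, in which case $N=M$.) For submonoids $M, N$ of $A^*$, $M \preceq N$ means that there is a submonoid $L \subseteq A^*$ with $N = M * L$. This relation is a partial order on the set of submonoids of $A^*$. *)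

theory Defs
  imports "HOL-Algebra.Group" "HOL.Hull"
begin

definition free_monoid :: "'a set \<Rightarrow> 'a list monoid"
  where "free_monoid A = \<lparr>carrier = lists A, mult = (@), one = []\<rparr>"

lemma monoid_free_monoid: "monoid (free_monoid A)"
  by (rule monoidI) (auto simp: free_monoid_def)

definition reduced_form :: "('a, 'b) monoid_scheme \<Rightarrow> 'a set \<Rightarrow> 'a set \<Rightarrow> 'a list \<Rightarrow> bool"
  where "reduced_form G M L ms \<longleftrightarrow>
    (\<forall>m \<in> set ms. m \<noteq> \<one>\<^bsub>G\<^esub> \<and> m \<in> M \<union> L) \<and>
    successively (\<lambda>x y. x \<in> M \<and> y \<in> L \<or> x \<in> L \<and> y \<in> M) ms"

text \<open>\<open>is_free_product N M L\<close> is the internal statement \<open>N = M * L\<close> for submonoids of \<open>N\<close>;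
  the hull is the submonoid of \<open>N\<close> generated by \<open>M \<union> L\<close>.\<close>

definition is_free_product :: "('a, 'b) monoid_scheme \<Rightarrow> 'a set \<Rightarrow> 'a set \<Rightarrow> bool"
  where "is_free_product N M L \<longleftrightarrow>
    monoid N \<and> submonoid M N \<and> submonoid L N \<and>
    (\<lambda>H. submonoid H N) hull (M \<union> L) = carrier N \<and>
    (\<forall>n \<in> carrier N. \<exists>!ms. reduced_form N M L ms \<and> foldr (\<otimes>\<^bsub>N\<^esub>) ms \<one>\<^bsub>N\<^esub> = n)"

definition free_factor :: "'a set \<Rightarrow> 'a list set \<Rightarrow> 'a list set \<Rightarrow> bool"
  where "free_factor A M N \<longleftrightarrow>
    submonoid M (free_monoid A) \<and> submonoid N (free_monoid A) \<and>
    (\<exists>L. submonoid L (free_monoid A) \<and> is_free_product (free_monoid A\<lparr>carrier := N\<rparr>) M L)"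

definition free_factor_maximal :: "'a set \<Rightarrow> 'a list set \<Rightarrow> bool"
  where "free_factor_maximal A N \<longleftrightarrow>
    submonoid N (free_monoid A) \<and>
    (\<forall>K. submonoid K (free_monoid A) \<and> free_factor A N K \<longrightarrow> K = N)"

end

theory Submission
  imports Defs
begin

text \<open>
  Maximal elements come from Zorn's lemma, so one needs that \<open>\<preceq>\<close> is transitive and that
  \<open>\<preceq>\<close>-chains have upper bounds. Transitivity is clear from the universal property of free
  products; it suffices to test that property against monoids of self-maps of a set, because letting
  \<open>M\<close> and \<open>L\<close> act on words of factors (van der Waerden's trick) recovers uniqueness of
  reduced forms. For chains, the complement \<open>L\<close> in \<open>N = M * L\<close> is determined by
  \<open>M\<close> and \<open>N\<close>: it consists of the elements of \<open>N\<close> without a nontrivial factor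
  from \<open>M\<close>. Free factors are closed under factors, so these complements increase along a
  chain, and their union is a complement in the union of the chain, since uniqueness of reduced
  forms only ever involves finitely many elements.
\<close>

section \<open>Submonoids of words, reduced forms and free products as plain set notions\<close>

definition append_closed :: "'a list set \<Rightarrow> bool"
  where "append_closed H \<longleftrightarrow> [] \<in> H \<and> (\<forall>x\<in>H. \<forall>y\<in>H. x @ y \<in> H)"

definition reduced :: "'a list set \<Rightarrow> 'a list set \<Rightarrow> 'a list list \<Rightarrow> bool"
  where "reduced M L ms \<longleftrightarrow> (\<forall>m\<in>set ms. m \<noteq> [] \<and> m \<in> M \<union> L) \<and>
    successively (\<lambda>x y. x \<in> M \<and> y \<in> L \<or> x \<in> L \<and> y \<in> M) ms"

definition free_prod :: "'a list set \<Rightarrow> 'a list set \<Rightarrow> 'a list set \<Rightarrow> bool"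
  where "free_prod N M L \<longleftrightarrow> append_closed N \<and> append_closed M \<and> append_closed L \<and>
    M \<subseteq> N \<and> L \<subseteq> N \<and> (\<forall>n\<in>N. \<exists>!ms. reduced M L ms \<and> concat ms = n)"

text \<open>A homomorphism from \<open>M\<close> into the self-maps of a type, given as a total
  function so that restriction to a smaller submonoid keeps the same \<open>f\<close>.\<close>

definition action_on :: "'a list set \<Rightarrow> ('a list \<Rightarrow> 's \<Rightarrow> 's) \<Rightarrow> bool"
  where "action_on M f \<longleftrightarrow> f [] = id \<and> (\<forall>x\<in>M. \<forall>y\<in>M. f (x @ y) = f x \<circ> f y)"

definition generated :: "'a list set \<Rightarrow> 'a list set"
  where "generated S = concat ` lists S"

lemma append_closed_nil: "append_closed H \<Longrightarrow> [] \<in> H"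
  by (simp add: append_closed_def)

lemma append_closed_append: "append_closed H \<Longrightarrow> x \<in> H \<Longrightarrow> y \<in> H \<Longrightarrow> x @ y \<in> H"
  by (simp add: append_closed_def)

lemma append_closed_concat: "append_closed H \<Longrightarrow> set ms \<subseteq> H \<Longrightarrow> concat ms \<in> H"
  by (induction ms) (auto simp: append_closed_def)

lemma append_closed_generated: "append_closed (generated S)"
  unfolding append_closed_def generated_def
proof (intro conjI ballI)
  show "[] \<in> concat ` lists S"
    by (rule image_eqI[of _ _ "[]"]) auto
next
  fix x y assume "x \<in> concat ` lists S" "y \<in> concat ` lists S"
  then obtain a b where "a \<in> lists S" "b \<in> lists S" "x = concat a" "y = concat b"
    by blast
  then show "x @ y \<in> concat ` lists S"
    by (intro image_eqI[of _ _ "a @ b"]) auto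
qed

lemma generated_superset: "S \<subseteq> generated S"
  unfolding generated_def by (rule subsetI, rule_tac x = "[x]" in image_eqI) auto

lemma generated_least: "S \<subseteq> H \<Longrightarrow> append_closed H \<Longrightarrow> generated S \<subseteq> H"
  by (auto simp: generated_def intro!: append_closed_concat)

lemma reduced_nil [simp]: "reduced M L []"
  by (simp add: reduced_def)

lemma reduced_Cons:
  "reduced M L (m # ms) \<longleftrightarrow> m \<noteq> [] \<and> m \<in> M \<union> L \<and> reduced M L ms \<and>
    (ms \<noteq> [] \<longrightarrow> m \<in> M \<and> hd ms \<in> L \<or> m \<in> L \<and> hd ms \<in> M)"
  by (cases ms) (auto simp: reduced_def)

lemma reduced_commute: "reduced M L ms \<longleftrightarrow> reduced L M ms"
  by (induction ms) (auto simp: reduced_Cons)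

lemma reduced_mono:
  "reduced M L ms \<Longrightarrow> M \<subseteq> M' \<Longrightarrow> L \<subseteq> L' \<Longrightarrow> reduced M' L' ms"
  by (induction ms) (auto simp: reduced_Cons)

lemma reduced_Int:
  "reduced M L ms \<Longrightarrow> set ms \<subseteq> N \<Longrightarrow> reduced (M \<inter> N) (L \<inter> N) ms"
  by (induction ms) (auto simp: reduced_Cons dest: hd_in_set)

lemma free_prodD:
  assumes "free_prod N M L"
  shows "append_closed N" "append_closed M" "append_closed L" "M \<subseteq> N" "L \<subseteq> N"
    "n \<in> N \<Longrightarrow> \<exists>!ms. reduced M L ms \<and> concat ms = n"
  using assms by (auto simp: free_prod_def)

lemma free_prod_commute: "free_prod N M L \<longleftrightarrow> free_prod N L M"
  by (auto simp: free_prod_def reduced_commute[of M L])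

lemma free_prod_concat_mem:
  assumes "free_prod N M L" "reduced M L ms"
  shows "concat ms \<in> N"
  using assms by (intro append_closed_concat) (auto simp: free_prod_def reduced_def)

lemma free_prod_inj:
  assumes "free_prod N M L" "reduced M L ms" "reduced M L ns" "concat ms = concat ns"
  shows "ms = ns"
  using free_prodD(6)[OF assms(1) free_prod_concat_mem[OF assms(1,2)]] assms by metis

lemma free_prod_eq_generated:
  assumes "free_prod N M L"
  shows "N = generated (M \<union> L)"
proof
  show "generated (M \<union> L) \<subseteq> N"
    using assms by (intro generated_least) (auto simp: free_prod_def)
  show "N \<subseteq> generated (M \<union> L)"
  proof
    fix n assume "n \<in> N"
    then obtain ms where "reduced M L ms" "concat ms = n"
      using free_prodD(6)[OF assms] by blast
    then show "n \<in> generated (M \<union> L)"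
      unfolding generated_def by (intro image_eqI[of _ _ ms]) (auto simp: reduced_def)
  qed
qed

text \<open>A nonempty \<open>x\<close> in both submonoids may follow itself in a reduced form, so
  \<open>[x, x]\<close> and \<open>[x @ x]\<close> would be two reduced forms of one word.\<close>

lemma free_prod_Int:
  assumes "free_prod N M L"
  shows "M \<inter> L = {[]}"
proof -
  have "x = []" if x: "x \<in> M" "x \<in> L" for x
  proof (rule ccontr)
    assume "x \<noteq> []"
    moreover have "x @ x \<in> M"
      using x free_prodD(2)[OF assms] by (simp add: append_closed_append)
    ultimately have "reduced M L [x, x]" "reduced M L [x @ x]"
      using x by (auto simp: reduced_Cons)
    from free_prod_inj[OF assms this] show False
      by simp
  qed
  moreover have "[] \<in> M \<inter> L"
    using free_prodD(2,3)[OF assms] by (simp add: append_closed_nil)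
  ultimately show ?thesis
    by blast
qed

section \<open>Actions of submonoids and the universal property of free products\<close>

lemma action_onD:
  assumes "action_on M f"
  shows "f [] = id" "x \<in> M \<Longrightarrow> y \<in> M \<Longrightarrow> f (x @ y) = f x \<circ> f y"
  using assms by (auto simp: action_on_def)

lemma action_on_trivial: "action_on M (\<lambda>_. id)"
  by (simp add: action_on_def)

lemma action_on_subset: "action_on N f \<Longrightarrow> M \<subseteq> N \<Longrightarrow> action_on M f"
  by (auto simp: action_on_def)

lemma action_on_concat:
  assumes "action_on N f" "append_closed N" "set ms \<subseteq> N"
  shows "f (concat ms) = foldr (\<lambda>m k. f m \<circ> k) ms id"
  using assms(3)
  by (induction ms) (auto simp: action_onD[OF assms(1)] append_closed_concat[OF assms(2)])

lemma action_on_generated_eq: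
  assumes "action_on N f" "action_on N g" "append_closed N" "S \<subseteq> N"
    and "\<And>x. x \<in> S \<Longrightarrow> f x = g x" and "x \<in> generated S"
  shows "f x = g x"
proof -
  obtain ms where ms: "set ms \<subseteq> S" "x = concat ms"
    using assms(6) by (auto simp: generated_def)
  then have "foldr (\<lambda>m k. f m \<circ> k) ms id = foldr (\<lambda>m k. g m \<circ> k) ms id"
    using assms(5) by (intro foldr_cong) auto
  moreover have "set ms \<subseteq> N"
    using ms(1) assms(4) by blast
  ultimately show ?thesis
    using ms(2) action_on_concat[OF assms(1,3)] action_on_concat[OF assms(2,3)] by simp
qed

text \<open>Normalisation after multiplying by one factor on the left: it is dropped, merged with
  the head, or put in front. None of these moves changes the composite under \<open>F\<close>, which
  is multiplicative on \<open>M\<close> and on \<open>L\<close>.\<close>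

lemma reduced_append:
  assumes "append_closed M" "append_closed L" "action_on M F" "action_on L F"
    and m: "m \<in> M \<union> L" and ms: "reduced M L ms"
  obtains ms' where "reduced M L ms'" "concat ms' = m @ concat ms"
    "foldr (\<lambda>m k. F m \<circ> k) ms' id = F m \<circ> foldr (\<lambda>m k. F m \<circ> k) ms id"
proof (cases "m = []")
  case True
  with ms that[of ms] show ?thesis
    by (simp add: action_onD(1)[OF assms(3)])
next
  case m_ne: False
  show ?thesis
  proof (cases ms)
    case Nil
    with m m_ne that[of "[m]"] show ?thesis
      by (simp add: reduced_Cons)
  next
    case (Cons x xs)
    show ?thesis
    proof (cases "m \<in> M \<and> x \<in> M \<or> m \<in> L \<and> x \<in> L")
      case True
      then have F: "F (m @ x) = F m \<circ> F x"
        using action_onD(2) assms(3,4) by blast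
      \<comment> \<open>\<open>M\<close> and \<open>L\<close> may overlap here. If \<open>x\<close>
        lies in both, the merged factor may come from the same submonoid as the head of
        \<open>xs\<close>; in that case \<open>m # ms\<close> already alternates.\<close>
      have "reduced M L ((m @ x) # xs) \<or> reduced M L (m # ms)"
        using True ms m_ne Cons assms(1,2) by (auto simp: reduced_Cons append_closed_append)
      then show ?thesis
      proof
        assume "reduced M L ((m @ x) # xs)"
        with that[of "(m @ x) # xs"] Cons F show ?thesis
          by (simp add: comp_assoc)
      next
        assume "reduced M L (m # ms)"
        with that[of "m # ms"] show ?thesis
          by simp
      qed
    next
      case False
      then have "reduced M L (m # ms)"
        using ms m_ne m Cons by (auto simp: reduced_Cons)
      with that[of "m # ms"] show ?thesis
        by simp
    qed
  qed
qed

text \<open>The universal property: \<open>h\<close> evaluates the unique reduced form of a word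
  factor by factor. It is multiplicative because normalising after multiplication by a factor
  preserves the evaluation.\<close>

lemma free_prod_extend_action:
  assumes N: "free_prod N M L" and f: "action_on M f" and g: "action_on L g"
  obtains h where "action_on N h" "\<And>x. x \<in> M \<Longrightarrow> h x = f x" "\<And>x. x \<in> L \<Longrightarrow> h x = g x"
proof -
  \<comment> \<open>The preference for \<open>f\<close> does no harm: \<open>M\<close> and
    \<open>L\<close> share only \<open>[]\<close>, where both actions are the identity.\<close>
  define F where "F m = (if m \<in> M then f m else g m)" for m
  define R where "R n = (THE ms. reduced M L ms \<and> concat ms = n)" for n
  define E where "E ms = foldr (\<lambda>m k. F m \<circ> k) ms id" for ms
  define h where "h n = E (R n)" for n
  note closed = free_prodD(1-3)[OF N] and sub = free_prodD(4,5)[OF N]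
  have FM: "F x = f x" if "x \<in> M" for x
    using that by (simp add: F_def)
  have FL: "F x = g x" if "x \<in> L" for x
  proof (cases "x \<in> M")
    case True
    then have "x = []"
      using that free_prod_Int[OF N] by blast
    then show ?thesis
      by (simp add: F_def action_onD(1)[OF f] action_onD(1)[OF g])
  qed (simp add: F_def)
  have FM_act: "action_on M F"
    using f closed(2) by (simp add: action_on_def FM append_closed_append append_closed_nil)
  have FL_act: "action_on L F"
    using g closed(3) by (simp add: action_on_def FL append_closed_append append_closed_nil)
  have R_eq: "R (concat ms) = ms" if "reduced M L ms" for ms
    unfolding R_def using that free_prod_inj[OF N] by (intro the_equality) auto
  have R: "reduced M L (R n)" "concat (R n) = n" if "n \<in> N" for n
    using that free_prodD(6)[OF N that] R_eq by metis+
  have step: "h (m @ n) = F m \<circ> h n" if m: "m \<in> M \<union> L" and n: "n \<in> N" for m n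
  proof -
    obtain ms' where "reduced M L ms'" "concat ms' = m @ concat (R n)"
      "foldr (\<lambda>m k. F m \<circ> k) ms' id = F m \<circ> foldr (\<lambda>m k. F m \<circ> k) (R n) id"
      using reduced_append[OF closed(2,3) FM_act FL_act m R(1)[OF n]] .
    then show ?thesis
      using R_eq[of ms'] R(2)[OF n] by (simp add: h_def E_def)
  qed
  have h_nil: "h [] = id"
    using R_eq[of "[]"] by (simp add: h_def E_def)
  have h_F: "h x = F x" if "x \<in> M \<union> L" for x
    using step[OF that append_closed_nil[OF closed(1)]] h_nil by simp
  have h_concat: "h (concat ms @ n) = E ms \<circ> h n" if "set ms \<subseteq> M \<union> L" "n \<in> N" for ms n
    using that(1)
  proof (induction ms)
    case (Cons m ms)
    have "concat ms \<in> N"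
      using Cons.prems sub by (intro append_closed_concat[OF closed(1)]) auto
    then have "h (m @ (concat ms @ n)) = F m \<circ> h (concat ms @ n)"
      using Cons.prems that(2) closed(1) by (intro step) (auto simp: append_closed_append)
    with Cons show ?case
      by (simp add: E_def comp_assoc)
  qed (simp add: E_def)
  have "h (x @ y) = h x \<circ> h y" if "x \<in> N" "y \<in> N" for x y
    using h_concat[of "R x" y] that R[of x] by (auto simp: h_def reduced_def)
  then have "action_on N h"
    using h_nil by (simp add: action_on_def)
  then show ?thesis
    using that h_F FM FL by auto
qed

section \<open>Recovering free products from actions; transitivity, reflexivity and factor
  closure\<close>

definition prepend :: "'a list set \<Rightarrow> 'a list \<Rightarrow> 'a list list \<Rightarrow> 'a list list"
  where "prepend M m ms =
    (if m = [] then ms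
     else case ms of [] \<Rightarrow> [m] | x # xs \<Rightarrow> if x \<in> M then (m @ x) # xs else m # ms)"

text \<open>\<open>prepend M\<close> is left multiplication on reduced forms, extended to all lists
  of words. It stays multiplicative there: after a nonempty element of \<open>M\<close> has acted,
  the head lies in \<open>M\<close> and merges with the next one.\<close>

lemma action_on_prepend: "append_closed M \<Longrightarrow> action_on M (prepend M)"
  unfolding action_on_def
proof (intro conjI ballI ext)
  fix x y ms assume "append_closed M" "x \<in> M" "y \<in> M"
  then show "prepend M (x @ y) ms = (prepend M x \<circ> prepend M y) ms"
    by (cases ms) (auto simp: prepend_def append_closed_append)
qed (auto simp: prepend_def)

text \<open>Converse of the universal property. When both submonoids act by \<open>prepend\<close>,
  the word \<open>concat ms\<close> sends the empty list to \<open>ms\<close>, so a reduced form can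
  be read off from its product. Reduced forms exist by generation and normalisation.\<close>

lemma free_prodI_action:
  fixes N M L :: "'a list set"
  assumes closed: "append_closed N" "append_closed M" "append_closed L"
    and sub: "M \<subseteq> N" "L \<subseteq> N" and gen: "N \<subseteq> generated (M \<union> L)"
    and ext: "\<And>f g :: 'a list \<Rightarrow> 'a list list \<Rightarrow> 'a list list.
      action_on M f \<Longrightarrow> action_on L g \<Longrightarrow>
      \<exists>h. action_on N h \<and> (\<forall>x\<in>M. h x = f x) \<and> (\<forall>x\<in>L. h x = g x)"
  shows "free_prod N M L"
proof -
  have disj: "x = []" if x: "x \<in> M" "x \<in> L" for x
  proof -
    \<comment> \<open>\<open>M\<close> acts by \<open>prepend\<close> and \<open>L\<close>
      trivially: a nonempty common \<open>x\<close> would send \<open>[]\<close> both to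
      \<open>[x]\<close> and to \<open>[]\<close>.\<close>
    obtain h where "\<forall>x\<in>M. h x = prepend M x" "\<forall>x\<in>L. h x = (id :: 'a list list \<Rightarrow> 'a list list)"
      using ext[OF action_on_prepend[OF closed(2)] action_on_trivial] by blast
    with x have "prepend M x [] = []"
      by (metis id_apply)
    then show ?thesis
      by (auto simp: prepend_def split: if_splits)
  qed
  obtain h where h: "action_on N h" "\<forall>x\<in>M. h x = prepend M x" "\<forall>x\<in>L. h x = prepend L x"
    using ext[OF action_on_prepend[OF closed(2)] action_on_prepend[OF closed(3)]] by blast
  have mem: "concat ms \<in> N" if "reduced M L ms" for ms
    using that sub by (intro append_closed_concat[OF closed(1)]) (auto simp: reduced_def)
  have h_nil: "h (concat ms) [] = ms" if "reduced M L ms" for ms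
    using that
  proof (induction ms)
    case Nil
    then show ?case
      using action_onD(1)[OF h(1)] by simp
  next
    case (Cons m ms)
    then have m: "m \<noteq> []" "m \<in> M \<union> L" and ms: "reduced M L ms"
      by (auto simp: reduced_Cons)
    have "h (concat (m # ms)) [] = h m ms"
      using action_onD(2)[OF h(1), of m "concat ms"] m sub mem[OF ms] Cons.IH[OF ms] by auto
    also have "\<dots> = m # ms"
    proof (cases ms)
      case Nil
      with m h show ?thesis
        by (auto simp: prepend_def)
    next
      case (Cons x xs)
      with Cons.prems have "x \<noteq> []" "m \<in> M \<and> x \<in> L \<or> m \<in> L \<and> x \<in> M"
        by (auto simp: reduced_Cons)
      with m Cons h(2,3) disj[of x] disj[of m] show ?thesis
        by (auto simp: prepend_def)
    qed
    finally show ?case .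
  qed
  have "\<exists>ms. reduced M L ms \<and> concat ms = concat ws" if "set ws \<subseteq> M \<union> L" for ws
    using that
  proof (induction ws)
    case Nil
    then show ?case
      by (auto intro: exI[of _ "[]"])
  next
    case (Cons w ws)
    then obtain ms where "reduced M L ms" "concat ms = concat ws" "w \<in> M \<union> L"
      by auto
    with reduced_append[OF closed(2,3) action_on_trivial action_on_trivial, of w ms]
    show ?case
      by (metis concat.simps(2))
  qed
  then have "\<exists>ms. reduced M L ms \<and> concat ms = n" if "n \<in> N" for n
    using that gen by (fastforce simp: generated_def)
  then show ?thesis
    using closed sub h_nil unfolding free_prod_def by metis
qed

text \<open>Associativity, \<open>(M * L) * P = M * (L * P)\<close>: an action of
  \<open>generated (L \<union> P)\<close> restricts to \<open>L\<close> and \<open>P\<close>, so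
  together with \<open>f\<close> it extends first from \<open>M\<close> and \<open>L\<close> to
  \<open>N\<close>, then from \<open>N\<close> and \<open>P\<close> to \<open>K\<close>.\<close>

lemma free_prod_trans:
  fixes K N M L P :: "'a list set"
  assumes N: "free_prod N M L" and K: "free_prod K N P"
  shows "free_prod K M (generated (L \<union> P))"
proof (rule free_prodI_action)
  note closed = append_closed_generated
  show "append_closed K" "append_closed M" "append_closed (generated (L \<union> P))"
    using free_prodD[OF N] free_prodD[OF K] closed by auto
  show "M \<subseteq> K"
    using free_prodD[OF N] free_prodD[OF K] by auto
  show sub: "generated (L \<union> P) \<subseteq> K"
    using free_prodD[OF N] free_prodD[OF K] by (intro generated_least) auto
  let ?S = "M \<union> generated (L \<union> P)"
  have "M \<union> L \<subseteq> generated ?S" "P \<subseteq> generated ?S"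
    using generated_superset[of ?S] generated_superset[of "L \<union> P"] by auto
  then have "N \<union> P \<subseteq> generated ?S"
    using generated_least[OF _ closed, of "M \<union> L" ?S] free_prod_eq_generated[OF N] by simp
  then show "K \<subseteq> generated ?S"
    using generated_least[OF _ closed, of "N \<union> P" ?S] free_prod_eq_generated[OF K] by simp
  fix f g :: "'a list \<Rightarrow> 'a list list \<Rightarrow> 'a list list"
  assume f: "action_on M f" and g: "action_on (generated (L \<union> P)) g"
  have "action_on L g" "action_on P g"
    using generated_superset[of "L \<union> P"] by (auto intro: action_on_subset[OF g])
  obtain h where h: "action_on N h" "\<And>x. x \<in> M \<Longrightarrow> h x = f x" "\<And>x. x \<in> L \<Longrightarrow> h x = g x"
    using free_prod_extend_action[OF N f \<open>action_on L g\<close>] by blast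
  obtain k where k: "action_on K k" "\<And>x. x \<in> N \<Longrightarrow> k x = h x" "\<And>x. x \<in> P \<Longrightarrow> k x = g x"
    using free_prod_extend_action[OF K h(1) \<open>action_on P g\<close>] by blast
  have "k x = g x" if "x \<in> generated (L \<union> P)" for x
  proof (rule action_on_generated_eq[OF _ g closed generated_superset _ that])
    show "action_on (generated (L \<union> P)) k"
      using action_on_subset[OF k(1) sub] .
    show "k x = g x" if "x \<in> L \<union> P" for x
      using that h(3) k(2,3) free_prodD(5)[OF N] by auto
  qed
  moreover have "k x = f x" if "x \<in> M" for x
    using that h(2) k(2) free_prodD(4)[OF N] by auto
  ultimately show "\<exists>h. action_on K h \<and> (\<forall>x\<in>M. h x = f x) \<and> (\<forall>x\<in>generated (L \<union> P). h x = g x)"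
    using k(1) by blast
qed

lemma free_prod_trivial:
  assumes "append_closed M"
  shows "free_prod M M {[]}"
proof (rule free_prodI_action)
  show "M \<subseteq> generated (M \<union> {[]})"
    using generated_superset[of "M \<union> {[]}"] by blast
  show "\<exists>h. action_on M h \<and> (\<forall>x\<in>M. h x = f x) \<and> (\<forall>x\<in>{[]}. h x = g x)"
    if "action_on M f" "action_on {[]} g" for f g :: "'a list \<Rightarrow> 'a list list \<Rightarrow> 'a list list"
    using that action_onD(1)[OF that(1)] action_onD(1)[OF that(2)] by auto
qed (use assms in \<open>auto simp: append_closed_def\<close>)

text \<open>Counting the total length of the \<open>L\<close>-factors is a homomorphism to the natural
  numbers whose zero set is \<open>M\<close>; it is realised as an action by translations.\<close>

lemma free_prod_factor_closed:
  assumes N: "free_prod N M L" and uv: "u \<in> N" "v \<in> N" "u @ v \<in> M"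
  shows "u \<in> M" "v \<in> M"
proof -
  have "action_on L (\<lambda>x. (+) (length x))"
    by (auto simp: action_on_def)
  then obtain h where h: "action_on N h" "\<And>x. x \<in> M \<Longrightarrow> h x = id"
    "\<And>x. x \<in> L \<Longrightarrow> h x = (+) (length x)"
    using free_prod_extend_action[OF N action_on_trivial] by blast
  note closed = free_prodD(1-3)[OF N] and sub = free_prodD(4,5)[OF N]
  \<comment> \<open>A factor outside \<open>M\<close> is nonempty and adds its positive length, so a
    zero shift leaves only factors from \<open>M\<close>.\<close>
  have *: "\<exists>k. h (concat ms) = (+) k \<and> (k = 0 \<longrightarrow> concat ms \<in> M)" if "set ms \<subseteq> M \<union> L" for ms
    using that
  proof (induction ms)
    case Nil
    then show ?case
      using action_onD(1)[OF h(1)] append_closed_nil[OF closed(2)]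
      by (auto simp: fun_eq_iff intro!: exI[of _ 0])
  next
    case (Cons m ms)
    then obtain k where k: "h (concat ms) = (+) k" "k = 0 \<longrightarrow> concat ms \<in> M"
      by auto
    have mem: "m \<in> N" "concat ms \<in> N"
      using Cons.prems sub by (auto intro!: append_closed_concat[OF closed(1)])
    have eq: "h (concat (m # ms)) = h m \<circ> (+) k"
      using action_onD(2)[OF h(1) mem] k(1) by simp
    show ?case
    proof (cases "m \<in> M")
      case True
      with eq k(2) show ?thesis
        using h(2) append_closed_append[OF closed(2)] by auto
    next
      case False
      then have "m \<in> L" "m \<noteq> []"
        using Cons.prems append_closed_nil[OF closed(2)] by auto
      then show ?thesis
        using eq h(3) by (auto simp: fun_eq_iff intro!: exI[of _ "length m + k"])
    qed
  qed
  have **: "\<exists>k. h n = (+) k \<and> (k = 0 \<longrightarrow> n \<in> M)" if "n \<in> N" for n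
    using that * unfolding free_prod_eq_generated[OF N] generated_def by auto
  obtain j k where jk: "h u = (+) j" "j = 0 \<longrightarrow> u \<in> M" "h v = (+) k" "k = 0 \<longrightarrow> v \<in> M"
    using **[OF uv(1)] **[OF uv(2)] by auto
  have "id = (+) j \<circ> (+) k"
    using action_onD(2)[OF h(1) uv(1,2)] h(2)[OF uv(3)] jk by simp
  from fun_cong[OF this, of 0] show "u \<in> M" "v \<in> M"
    using jk by auto
qed

section \<open>Canonical complements and unions of chains\<close>

definition complement :: "'a list set \<Rightarrow> 'a list set \<Rightarrow> 'a list set"
  where "complement M N = {n \<in> N. \<forall>u\<in>N. \<forall>m\<in>M. \<forall>v\<in>N. n = u @ m @ v \<longrightarrow> m = []}"

text \<open>By symmetry \<open>L\<close> is closed under factors in \<open>N\<close>, so a factor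
  from \<open>M\<close> of a word in \<open>L\<close> lies in both and is empty. Conversely, the
  entries from \<open>M\<close> in a factorisation of a word of the complement are empty. The
  cofactors must lie in \<open>N\<close>: with \<open>M\<close> generated by \<open>b\<close> and
  \<open>L\<close> by \<open>aba\<close>, the word \<open>aba\<close> contains \<open>b\<close>, but
  not as a factor in \<open>N\<close>.\<close>

lemma free_prod_complement:
  assumes N: "free_prod N M L"
  shows "L = complement M N"
proof
  note closed = free_prodD(1-3)[OF N] and sub = free_prodD(4,5)[OF N]
  have N': "free_prod N L M"
    using N free_prod_commute by blast
  show "L \<subseteq> complement M N"
  proof
    fix n assume n: "n \<in> L"
    have "m = []" if "u \<in> N" "m \<in> M" "v \<in> N" "n = u @ m @ v" for u m v
    proof -
      have "m @ v \<in> L"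
        using free_prod_factor_closed(2)[OF N', of u "m @ v"] that n sub closed(1)
        by (auto simp: append_closed_append)
      then have "m \<in> L"
        using free_prod_factor_closed(1)[OF N', of m v] that sub by auto
      with that(2) show ?thesis
        using free_prod_Int[OF N] by auto
    qed
    with n sub show "n \<in> complement M N"
      unfolding complement_def by blast
  qed
  show "complement M N \<subseteq> L"
  proof
    fix n assume n: "n \<in> complement M N"
    then have "n \<in> generated (M \<union> L)"
      using free_prod_eq_generated[OF N] by (simp add: complement_def)
    then obtain ms where ms: "set ms \<subseteq> M \<union> L" "n = concat ms"
      by (auto simp: generated_def)
    have "m \<in> L" if m: "m \<in> set ms" for m
    proof (cases "m \<in> M")
      case True
      obtain xs ys where "ms = xs @ m # ys"
        using split_list[OF m] by blast
      moreover from this have "concat xs \<in> N" "concat ys \<in> N"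
        using ms(1) sub by (auto intro!: append_closed_concat[OF closed(1)])
      ultimately have "m = []"
        using n ms(2) True unfolding complement_def by auto
      then show ?thesis
        using append_closed_nil[OF closed(3)] by simp
    qed (use m ms in auto)
    then show "n \<in> L"
      unfolding ms(2) by (intro append_closed_concat[OF closed(3)]) auto
  qed
qed

text \<open>Any member of the chain may take the role of \<open>M\<close>, which makes the union an
  upper bound.\<close>

lemma free_prod_Union_chain:
  assumes ne: "C \<noteq> {}" and M: "M \<in> C"
    and chain: "\<And>X Y. X \<in> C \<Longrightarrow> Y \<in> C \<Longrightarrow> (\<exists>L. free_prod Y X L) \<or> (\<exists>L. free_prod X Y L)"
  shows "\<exists>L. free_prod (\<Union>C) M L"
proof -
  have fp: "free_prod Y X (complement X Y)" if XY: "X \<in> C" "Y \<in> C" "X \<subseteq> Y" for X Y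
  proof -
    \<comment> \<open>If the chain gives the relation in the opposite direction, the inclusion
      forces \<open>X = Y\<close>, and the relation reads both ways.\<close>
    have "Y = X" if "free_prod X Y L" for L
      using free_prodD(4)[OF that] \<open>X \<subseteq> Y\<close> by blast
    then obtain L where "free_prod Y X L"
      using chain[OF XY(1,2)] chain[OF XY(1,1)] by blast
    then show ?thesis
      using free_prod_complement by metis
  qed
  have closed: "append_closed X" if "X \<in> C" for X
    using free_prodD(1)[OF fp[OF that that]] by simp
  have comparable: "X \<subseteq> Y \<or> Y \<subseteq> X" if "X \<in> C" "Y \<in> C" for X Y
    using chain[OF that] free_prodD(4) by blast
  have directed: "\<exists>X\<in>C. M \<subseteq> X \<and> S \<subseteq> X" if "finite S" "S \<subseteq> \<Union>C" for S
    using that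
  proof (induction S)
    case empty
    then show ?case
      using M by blast
  next
    case (insert x S)
    then obtain X Y where "X \<in> C" "M \<subseteq> X" "S \<subseteq> X" "Y \<in> C" "x \<in> Y"
      by auto
    with comparable[of X Y] show ?case
      by blast
  qed
  \<comment> \<open>Members not containing \<open>M\<close> are contained in it, so those in
    \<open>?D\<close> still cover the union.\<close>
  let ?N = "\<Union>C" and ?D = "{Y \<in> C. M \<subseteq> Y}"
  define L where "L = (\<Union>Y\<in>?D. complement M Y)"
  have N_closed: "append_closed ?N"
    unfolding append_closed_def
  proof (intro conjI ballI)
    show "[] \<in> ?N"
      using M append_closed_nil[OF closed[OF M]] by blast
    fix x y assume "x \<in> ?N" "y \<in> ?N"
    then obtain X where "X \<in> C" "x \<in> X" "y \<in> X"
      using directed[of "{x, y}"] by auto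
    then show "x @ y \<in> ?N"
      using append_closed_append[OF closed] by blast
  qed
  \<comment> \<open>Passing from \<open>Y\<close> to \<open>Z\<close> adds no factorisations of
    \<open>n\<close>: \<open>Y\<close> is a free factor of \<open>Z\<close>, so all pieces of a
    factorisation of \<open>n\<close> in \<open>Z\<close> already lie in \<open>Y\<close>.\<close>
  have mono: "complement M Y \<subseteq> complement M Z" if "Y \<in> C" "Z \<in> C" "Y \<subseteq> Z" "M \<subseteq> Y" for Y Z
  proof
    fix n assume n: "n \<in> complement M Y"
    have "m = []" if uv: "u \<in> Z" "m \<in> M" "v \<in> Z" "n = u @ m @ v" for u m v
    proof -
      note fc = free_prod_factor_closed[OF fp[OF \<open>Y \<in> C\<close> \<open>Z \<in> C\<close> \<open>Y \<subseteq> Z\<close>]]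
      have Y: "n \<in> Y" "m @ v \<in> Z"
        using n uv \<open>Y \<subseteq> Z\<close> \<open>M \<subseteq> Y\<close> closed[OF \<open>Z \<in> C\<close>]
        by (auto simp: complement_def append_closed_append subset_iff)
      then have "u \<in> Y" "m @ v \<in> Y"
        using fc[of u "m @ v"] uv by auto
      moreover from this have "v \<in> Y"
        using fc(2)[of m v] uv \<open>Y \<subseteq> Z\<close> \<open>M \<subseteq> Y\<close> by auto
      ultimately show ?thesis
        using n uv by (auto simp: complement_def)
    qed
    with n \<open>Y \<subseteq> Z\<close> show "n \<in> complement M Z"
      unfolding complement_def by blast
  qed
  \<comment> \<open>An element from a smaller \<open>Z\<close> is carried up by \<open>mono\<close>;
    one from a larger \<open>Z\<close> passes the test in \<open>Y\<close>, which checks fewer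
    factorisations.\<close>
  have L_Int: "L \<inter> Y \<subseteq> complement M Y" if Y: "Y \<in> ?D" for Y
  proof
    fix n assume n: "n \<in> L \<inter> Y"
    then obtain Z where Z: "Z \<in> ?D" "n \<in> complement M Z"
      by (auto simp: L_def)
    then consider "Z \<subseteq> Y" | "Y \<subseteq> Z"
      using comparable Y by blast
    then show "n \<in> complement M Y"
    proof cases
      case 1
      with mono[of Z Y] Y Z show ?thesis
        by auto
    next
      case 2
      with n Z show ?thesis
        unfolding complement_def by blast
    qed
  qed
  have L_sub: "L \<subseteq> ?N"
    unfolding L_def complement_def by blast
  have L_closed: "append_closed L"
    unfolding append_closed_def
  proof (intro conjI ballI)
    have comp_closed: "append_closed (complement M Y)" if "Y \<in> ?D" for Y
      using free_prodD(3)[OF fp[OF M]] that by auto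
    show "[] \<in> L"
      using append_closed_nil[OF comp_closed[of M]] M by (auto simp: L_def)
    fix x y assume xy: "x \<in> L" "y \<in> L"
    then obtain Y where Y: "Y \<in> ?D" "{x, y} \<subseteq> Y"
      using directed[of "{x, y}"] L_sub by blast
    with xy L_Int[OF Y(1)] have "x @ y \<in> complement M Y"
      by (intro append_closed_append[OF comp_closed[OF Y(1)]]) auto
    with Y(1) show "x @ y \<in> L"
      by (auto simp: L_def)
  qed
  have ex: "\<exists>ms. reduced M L ms \<and> concat ms = n" if n: "n \<in> ?N" for n
  proof -
    obtain Y where Y: "Y \<in> ?D" "n \<in> Y"
      using directed[of "{n}"] n by auto
    then obtain ms where "reduced M (complement M Y) ms" "concat ms = n"
      using free_prodD(6)[OF fp[OF M]] by blast
    moreover have "complement M Y \<subseteq> L"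
      using Y by (auto simp: L_def)
    ultimately show ?thesis
      using reduced_mono by blast
  qed
  have uniq: "ms = ns"
    if red: "reduced M L ms" "reduced M L ns" and eq: "concat ms = concat ns" for ms ns
  proof -
    have "set ms \<union> set ns \<subseteq> ?N"
      using red L_sub M by (auto simp: reduced_def)
    then obtain Y where Y: "Y \<in> ?D" "set ms \<union> set ns \<subseteq> Y"
      using directed[of "set ms \<union> set ns"] by auto
    have "reduced M (complement M Y) xs" if "reduced M L xs" "set xs \<subseteq> Y" for xs
      using reduced_mono[OF reduced_Int[OF that]] L_Int[OF Y(1)] by auto
    with Y red eq show ?thesis
      using free_prod_inj[OF fp[OF M, of Y]] by auto
  qed
  have "free_prod ?N M L"
    unfolding free_prod_def using N_closed closed[OF M] L_closed M L_sub ex uniq by blast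
  then show ?thesis ..
qed

section \<open>Translation between the set notions and the monoid definitions\<close>

lemma submonoid_free_monoid_iff:
  "submonoid H (free_monoid A) \<longleftrightarrow> H \<subseteq> lists A \<and> append_closed H"
  by (auto simp: submonoid_def free_monoid_def append_closed_def)

lemma submonoid_restrict_iff:
  "submonoid H (free_monoid A\<lparr>carrier := N\<rparr>) \<longleftrightarrow> H \<subseteq> N \<and> append_closed H"
  by (auto simp: submonoid_def free_monoid_def append_closed_def)

lemma is_free_product_iff:
  "is_free_product (free_monoid A\<lparr>carrier := N\<rparr>) M L \<longleftrightarrow> free_prod N M L"
proof -
  let ?G = "free_monoid A\<lparr>carrier := N\<rparr>"
  have red: "reduced_form ?G M L ms = reduced M L ms" for ms
    by (simp add: reduced_form_def reduced_def free_monoid_def)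
  have fold: "foldr (\<otimes>\<^bsub>?G\<^esub>) ms \<one>\<^bsub>?G\<^esub> = concat ms" for ms
    by (simp add: free_monoid_def concat_conv_foldr)
  have mon: "monoid ?G \<longleftrightarrow> append_closed N"
    by (auto simp: monoid_def free_monoid_def append_closed_def)
  \<comment> \<open>Every element is the product of its reduced form, hence lies in any submonoid
    containing \<open>M \<union> L\<close>.\<close>
  have hull: "(\<lambda>H. submonoid H ?G) hull (M \<union> L) = N" if "free_prod N M L"
  proof (rule hull_unique)
    show "M \<union> L \<subseteq> N" "submonoid N ?G"
      using free_prodD[OF that] by (auto simp: submonoid_restrict_iff)
    show "N \<subseteq> H" if "M \<union> L \<subseteq> H" "submonoid H ?G" for H
      using that generated_least[of "M \<union> L" H] free_prod_eq_generated[OF \<open>free_prod N M L\<close>]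
      by (simp add: submonoid_restrict_iff)
  qed
  have carrier: "carrier ?G = N"
    by simp
  show ?thesis
    using hull unfolding is_free_product_def red fold mon submonoid_restrict_iff carrier
    by (auto simp: free_prod_def)
qed

lemma free_factor_iff:
  "free_factor A M N \<longleftrightarrow> N \<subseteq> lists A \<and> (\<exists>L. free_prod N M L)"
proof -
  have "append_closed N" "append_closed M" "append_closed L" "M \<subseteq> N" "L \<subseteq> N"
    if "free_prod N M L" for L
    using free_prodD[OF that] by auto
  then show ?thesis
    unfolding free_factor_def is_free_product_iff submonoid_free_monoid_iff by (meson order_trans)
qed

section \<open>Maximal elements by Zorn's lemma\<close>

theorem theorem4p5:
  fixes A :: "'a set" and M :: "'a list set"
  assumes "submonoid M (free_monoid A)"
  shows "\<exists>N. submonoid N (free_monoid A) \<and> M \<subseteq> N \<and> free_factor A M N \<and> free_factor_maximal A N"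
proof -
  \<comment> \<open>Zorn's lemma is applied to the submonoids above \<open>M\<close>, so that the
    maximal element found has \<open>M\<close> as a free factor.\<close>
  let ?S = "{N. free_factor A M N}"
  have trans: "free_factor A X Z" if "free_factor A X Y" "free_factor A Y Z" for X Y Z
    using that free_prod_trans unfolding free_factor_iff by blast
  have refl: "free_factor A X X" if "submonoid X (free_monoid A)" for X
    using that free_prod_trivial by (auto simp: free_factor_iff submonoid_free_monoid_iff)
  have sub: "X \<subseteq> Y" if "free_factor A X Y" for X Y
    using that by (auto simp: free_factor_iff dest: free_prodD)
  have mon: "submonoid N (free_monoid A)" if "free_factor A X N" for X N
    using that by (simp add: free_factor_def)
  have "\<exists>N\<in>?S. \<forall>K\<in>?S. free_factor A N K \<longrightarrow> K = N"
  proof (rule predicate_Zorn)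
    show "partial_order_on ?S (relation_of (free_factor A) ?S)"
    proof (rule partial_order_on_relation_ofI)
      show "free_factor A X X" if "X \<in> ?S" for X
        using that mon refl by auto
      show "free_factor A X Z" if "free_factor A X Y" "free_factor A Y Z" for X Y Z
        using that by (rule trans)
      show "X = Y" if "free_factor A X Y" "free_factor A Y X" for X Y
        using that sub by blast
    qed
    fix C assume "C \<in> Chains (relation_of (free_factor A) ?S)"
    then have C: "C \<subseteq> ?S" "\<And>X Y. X \<in> C \<Longrightarrow> Y \<in> C \<Longrightarrow> free_factor A X Y \<or> free_factor A Y X"
      by (auto simp: Chains_def relation_of_def)
    show "\<exists>U\<in>?S. \<forall>X\<in>C. free_factor A X U"
    proof (cases "C = {}")
      \<comment> \<open>The empty chain is bounded by \<open>M\<close> itself, which lies in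
        \<open>?S\<close> by reflexivity.\<close>
      case True
      then show ?thesis
        using refl[OF assms] by blast
    next
      case False
      have "\<Union>C \<subseteq> lists A"
        using C(1) by (auto simp: free_factor_iff)
      moreover have "\<exists>L. free_prod (\<Union>C) X L" if "X \<in> C" for X
        using free_prod_Union_chain[OF False that] C(2) unfolding free_factor_iff by blast
      ultimately have U: "free_factor A X (\<Union>C)" if "X \<in> C" for X
        using that by (simp add: free_factor_iff)
      moreover obtain X where "X \<in> C"
        using False by blast
      ultimately have "free_factor A M (\<Union>C)"
        using C(1) trans by blast
      with U show ?thesis
        by blast
    qed
  qed
  then obtain N where N: "free_factor A M N"
    "\<And>K. free_factor A M K \<Longrightarrow> free_factor A N K \<Longrightarrow> K = N"
    by blast
  \<comment> \<open>Anything above \<open>N\<close> is above \<open>M\<close> by transitivity, so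
    maximality within \<open>?S\<close> is maximality among all submonoids.\<close>
  have "free_factor_maximal A N"
    unfolding free_factor_maximal_def using mon[OF N(1)] N trans by blast
  with N(1) mon sub show ?thesis
    by blast
qed

end
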